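(* Let $H$ be a graded commutative Hopf $(\Gamma,\omega)$-algebra with co-multiplication $\Delta(f)=\sum f_{(1)}\otimes f_{(2)}$, co-unit $\varepsilon$ and antipode $S$. For every finitely generated graded commutative associative unital $(\Gamma,\omega)$-algebra $R$, let $G(R)$ be the set of $(\Gamma,\omega)$-algebra homomorphisms $H\to R$. Then $G(R)$ forms a group with multiplication, inverse map $$\mu_0(\varphi,\psi)(f)=\sum_{(f)}\varphi(f_{(1)})\psi(f_{(2)}),\qquad S_0(\varphi)(f)=\varphi(S(f)),\qquad f\in H,$$ and identity element the co-unit $\varepsilon$ of $H$ (viewed as the homomorphism $f\mapsto\varepsilon(f)1_R$); the maps $\mu_0$ and $S_0$ are natural in $R$, so that $R\mapsto G(R)$ is a group functor.
   Context: All vector spaces are over $\mathbb C$. $\Gamma$ is an additive abelian group with a commutative factor $\omega:\Gamma\times\Gamma\to\mathbb C^*$, i.e. $\omega(\alpha,\beta)=\omega(\beta,\alpha)^{-1}$ and $\omega$ is multiplicative in each argument. $d(x)$ is the degree of a homogeneous element; formulas with $d$ are extended linearly. A $(\Gamma,\omega)$-algebra is a $\Gamma$-graded unital associative algebra $A=\bigoplus_\alpha A_\alpha$; it is graded commutative if $xy=\omega(d(x),d(y))yx$ for homogeneous $x,y$. Homomorphisms of $(\Gamma,\omega)$-algebras are unital algebra homomorphisms of degree $0$. The tensor product $A\otimes B$ has multiplication $(a\otimes b)(a'\otimes b')=\omega(d(b),d(a'))aa'\otimes bb'$. A Hopf $(\Gamma,\omega)$-algebra is a $(\Gamma,\omega)$-algebra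 $H$ with $(\Gamma,\omega)$-algebra homomorphisms $\Delta:H\to H\otimes H$, $\varepsilon:H\to\mathbb C$ satisfying $(\Delta\otimes\mathrm{id})\Delta=(\mathrm{id}\otimes\Delta)\Delta$ and $(\varepsilon\otimes\mathrm{id})\Delta=\mathrm{id}=(\mathrm{id}\otimes\varepsilon)\Delta$, and a degree $0$ linear map $S:H\to H$ with $S(xy)=\omega(d(x),d(y))S(y)S(x)$ and $\sum S(x_{(1)})x_{(2)}=\sum x_{(1)}S(x_{(2)})=\varepsilon(x)1$. *)

theory Defs
  imports Complex_Main "HOL-Algebra.Group" "HOL-Library.Poly_Mapping"
begin

section \<open>Complex vector spaces and algebras\<close>

class complex_vector = ab_group_add +
  fixes scaleC :: "complex \<Rightarrow> 'a \<Rightarrow> 'a"  (infixr \<open>*\<^sub>C\<close> 75)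
  assumes scaleC_add_right: "c *\<^sub>C (x + y) = c *\<^sub>C x + c *\<^sub>C y"
    and scaleC_add_left: "(c + d) *\<^sub>C x = c *\<^sub>C x + d *\<^sub>C x"
    and scaleC_scaleC: "c *\<^sub>C d *\<^sub>C x = (c * d) *\<^sub>C x"
    and scaleC_one: "1 *\<^sub>C x = x"

global_interpretation cvec: vector_space "scaleC :: complex \<Rightarrow> 'a \<Rightarrow> 'a::complex_vector"
  by unfold_locales (simp_all add: scaleC_add_right scaleC_add_left scaleC_scaleC scaleC_one)

abbreviation clinear :: "('a::complex_vector \<Rightarrow> 'b::complex_vector) \<Rightarrow> bool"
  where "clinear \<equiv> Vector_Spaces.linear scaleC scaleC"

lemma clinearI:
  assumes "\<And>x y. f (x + y) = f x + f y" and "\<And>c x. f (c *\<^sub>C x) = c *\<^sub>C f x"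
  shows "clinear f"
  by unfold_locales (simp_all add: assms scaleC_add_right scaleC_add_left scaleC_scaleC scaleC_one)

definition cbilinear :: "('a::complex_vector \<Rightarrow> 'b::complex_vector \<Rightarrow> 'c::complex_vector) \<Rightarrow> bool"
  where "cbilinear f \<longleftrightarrow> (\<forall>a. clinear (f a)) \<and> (\<forall>b. clinear (\<lambda>a. f a b))"

text \<open>Associative unital algebras. The class \<^class>\<open>ring_1\<close> is avoided because it excludes
  the zero algebra.\<close>

class complex_algebra = complex_vector + ring + monoid_mult +
  assumes scaleC_mult_left: "(c *\<^sub>C x) * y = c *\<^sub>C (x * y)"
    and scaleC_mult_right: "x * (c *\<^sub>C y) = c *\<^sub>C (x * y)"

instantiation complex :: complex_algebra
begin
definition scaleC_complex :: "complex \<Rightarrow> complex \<Rightarrow> complex"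
  where "scaleC_complex c x = c * x"
instance
  by standard (simp_all add: scaleC_complex_def algebra_simps)
end

definition subalgebra :: "'a::complex_algebra set \<Rightarrow> bool"
  where "subalgebra B \<longleftrightarrow> cvec.subspace B \<and> 1 \<in> B \<and> (\<forall>x\<in>B. \<forall>y\<in>B. x * y \<in> B)"

definition finitely_generated_algebra :: "'a::complex_algebra itself \<Rightarrow> bool"
  where "finitely_generated_algebra T \<longleftrightarrow> (\<exists>X::'a set. finite X \<and> subalgebra hull X = UNIV)"


section \<open>Tensor products\<close>

text \<open>The tensor product is the free vector space on pairs modulo the subspace spanned by the
  bilinearity relations.\<close>

instantiation poly_mapping :: (type, complex_vector) complex_vector
begin
definition scaleC_poly_mapping :: "complex \<Rightarrow> ('a \<Rightarrow>\<^sub>0 'b) \<Rightarrow> ('a \<Rightarrow>\<^sub>0 'b)"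
  where "scaleC_poly_mapping c = Poly_Mapping.map (scaleC c)"

lemma lookup_scaleC: "Poly_Mapping.lookup (c *\<^sub>C p) k = c *\<^sub>C Poly_Mapping.lookup p k"
  for p :: "'a \<Rightarrow>\<^sub>0 'b"
  by (simp add: scaleC_poly_mapping_def Poly_Mapping.map.rep_eq when_def cvec.scale_zero_right)

instance
  by standard
    (auto intro!: poly_mapping_eqI
      simp: lookup_scaleC lookup_add scaleC_add_right scaleC_add_left scaleC_scaleC scaleC_one)
end

definition tensor_relations :: "('a::complex_vector \<times> 'b::complex_vector \<Rightarrow>\<^sub>0 complex) set"
  where "tensor_relations =
    {Poly_Mapping.single (a + a', b) 1 - Poly_Mapping.single (a, b) 1
       - Poly_Mapping.single (a', b) 1 | a a' b. True} \<union>
    {Poly_Mapping.single (a, b + b') 1 - Poly_Mapping.single (a, b) 1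
       - Poly_Mapping.single (a, b') 1 | a b b'. True} \<union>
    {Poly_Mapping.single (c *\<^sub>C a, b) 1 - c *\<^sub>C Poly_Mapping.single (a, b) 1 | c a b. True} \<union>
    {Poly_Mapping.single (a, c *\<^sub>C b) 1 - c *\<^sub>C Poly_Mapping.single (a, b) 1 | c a b. True}"

definition tensor_eq ::
    "('a::complex_vector \<times> 'b::complex_vector \<Rightarrow>\<^sub>0 complex) \<Rightarrow> ('a \<times> 'b \<Rightarrow>\<^sub>0 complex) \<Rightarrow> bool"
  where "tensor_eq p q \<longleftrightarrow> p - q \<in> cvec.span tensor_relations"

lemma tensor_eq_equivp: "equivp (tensor_eq :: ('a::complex_vector \<times> 'b::complex_vector \<Rightarrow>\<^sub>0 complex) \<Rightarrow> _)"
proof (rule equivpI)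
  show "reflp (tensor_eq :: ('a \<times> 'b \<Rightarrow>\<^sub>0 complex) \<Rightarrow> _)"
    by (rule reflpI) (simp add: tensor_eq_def cvec.span_zero)
  show "symp (tensor_eq :: ('a \<times> 'b \<Rightarrow>\<^sub>0 complex) \<Rightarrow> _)"
    unfolding tensor_eq_def by (rule sympI, drule cvec.span_neg) simp
  show "transp (tensor_eq :: ('a \<times> 'b \<Rightarrow>\<^sub>0 complex) \<Rightarrow> _)"
    unfolding tensor_eq_def by (rule transpI, drule (1) cvec.span_add) simp
qed

quotient_type (overloaded) ('a, 'b) tensor =
  "'a::complex_vector \<times> 'b::complex_vector \<Rightarrow>\<^sub>0 complex" / tensor_eq
  by (rule tensor_eq_equivp)

instantiation tensor :: (complex_vector, complex_vector) complex_vector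
begin
lift_definition zero_tensor :: "('a, 'b) tensor" is 0 .
lift_definition plus_tensor :: "('a, 'b) tensor \<Rightarrow> ('a, 'b) tensor \<Rightarrow> ('a, 'b) tensor" is "(+)"
  unfolding tensor_eq_def by (drule (1) cvec.span_add) (simp add: algebra_simps)
lift_definition minus_tensor :: "('a, 'b) tensor \<Rightarrow> ('a, 'b) tensor \<Rightarrow> ('a, 'b) tensor" is "(-)"
  unfolding tensor_eq_def by (drule (1) cvec.span_diff) (simp add: algebra_simps)
lift_definition uminus_tensor :: "('a, 'b) tensor \<Rightarrow> ('a, 'b) tensor" is uminus
  unfolding tensor_eq_def by (drule cvec.span_neg) (simp add: algebra_simps)
lift_definition scaleC_tensor :: "complex \<Rightarrow> ('a, 'b) tensor \<Rightarrow> ('a, 'b) tensor" is scaleC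
  unfolding tensor_eq_def by (drule cvec.span_scale) (simp add: cvec.scale_right_diff_distrib)
instance
  by (standard; transfer)
    (simp_all add: tensor_eq_def cvec.span_zero algebra_simps
      scaleC_add_right scaleC_add_left scaleC_scaleC scaleC_one)
end

lift_definition pure_tensor ::
    "'a::complex_vector \<Rightarrow> 'b::complex_vector \<Rightarrow> ('a, 'b) tensor"  (infixr \<open>\<otimes>\<^sub>C\<close> 73)
  is "\<lambda>a b. Poly_Mapping.single (a, b) 1" .

text \<open>The linear map on the tensor product induced by \<open>f\<close>, that is
  \<open>\<Sum> a\<^sub>i \<otimes>\<^sub>C b\<^sub>i \<mapsto> \<Sum> f a\<^sub>i b\<^sub>i\<close>. It is computed on a chosen representative; for bilinear \<open>f\<close>
  the choice does not matter, see \<open>tensor_lift_pure\<close> and \<open>clinear_tensor_lift\<close> below.\<close>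

definition tensor_lift ::
    "('a::complex_vector \<Rightarrow> 'b::complex_vector \<Rightarrow> 'c::complex_vector) \<Rightarrow> ('a, 'b) tensor \<Rightarrow> 'c"
  where "tensor_lift f t =
    (\<Sum>(a, b)\<in>Poly_Mapping.keys (rep_tensor t). Poly_Mapping.lookup (rep_tensor t) (a, b) *\<^sub>C f a b)"

lemma cbilinearD:
  assumes "cbilinear f"
  shows "f (a + a') b = f a b + f a' b" "f a (b + b') = f a b + f a b'"
    "f (c *\<^sub>C a) b = c *\<^sub>C f a b" "f a (c *\<^sub>C b) = c *\<^sub>C f a b"
  using assms by (auto simp: cbilinear_def Vector_Spaces.linear_iff)

lemma
  fixes f :: "'a::complex_vector \<Rightarrow> 'b::complex_vector \<Rightarrow> 'c::complex_vector"
  assumes f: "cbilinear f"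
  shows clinear_tensor_lift: "clinear (tensor_lift f)"
    and tensor_lift_pure: "tensor_lift f (a \<otimes>\<^sub>C b) = f a b"
proof -
  define E where "E p = (\<Sum>(a, b)\<in>Poly_Mapping.keys p. Poly_Mapping.lookup p (a, b) *\<^sub>C f a b)"
    for p :: "'a \<times> 'b \<Rightarrow>\<^sub>0 complex"
  have E_eq: "E p = (\<Sum>(a, b)\<in>K. Poly_Mapping.lookup p (a, b) *\<^sub>C f a b)"
    if "finite K" "Poly_Mapping.keys p \<subseteq> K" for p K
    unfolding E_def using that
    by (intro sum.mono_neutral_left) (auto simp: not_in_keys_iff_lookup_eq_zero)
  have E_add: "E (p + q) = E p + E q" for p q
  proof -
    let ?K = "Poly_Mapping.keys p \<union> Poly_Mapping.keys q"
    have "Poly_Mapping.keys (p + q) \<subseteq> ?K" by (rule Poly_Mapping.keys_add)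
    then show ?thesis
      using E_eq[of ?K p] E_eq[of ?K q] E_eq[of ?K "p + q"]
      by (simp add: lookup_add scaleC_add_left split_def sum.distrib)
  qed
  have E_scale: "E (c *\<^sub>C p) = c *\<^sub>C E p" for c p
  proof -
    have "Poly_Mapping.keys (c *\<^sub>C p) \<subseteq> Poly_Mapping.keys p"
      by (auto simp: in_keys_iff lookup_scaleC scaleC_complex_def)
    then have "E (c *\<^sub>C p) =
        (\<Sum>(a, b)\<in>Poly_Mapping.keys p. Poly_Mapping.lookup (c *\<^sub>C p) (a, b) *\<^sub>C f a b)"
      by (intro E_eq) auto
    then show ?thesis
      by (simp add: E_def lookup_scaleC scaleC_complex_def split_def
          cvec.scale_sum_right)
  qed
  have E_linear: "clinear E" by (intro clinearI E_add E_scale)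
  have E_single: "E (Poly_Mapping.single (a, b) 1) = f a b" for a b
    by (simp add: E_def scaleC_one)
  have E_diff: "E (p - q) = E p - E q" for p q
    using E_add[of "p - q" q] by (simp add: algebra_simps)
  have E_relation: "E r = 0" if "r \<in> tensor_relations" for r
    using that unfolding tensor_relations_def
    by (auto simp: E_diff E_scale E_single cbilinearD[OF f])
  have "E r = 0" if "r \<in> cvec.span tensor_relations" for r
    using that
    by (induction rule: cvec.span_induct_alt)
      (use E_add[of 0 0] in \<open>simp_all add: E_add E_scale E_relation\<close>)
  then have E_cong: "E p = E q" if "tensor_eq p q" for p q
    using that E_diff[of p q] by (simp add: tensor_eq_def)
  have lift_abs: "tensor_lift f (abs_tensor p) = E p" for p
    unfolding tensor_lift_def E_def[symmetric]
    by (intro E_cong rep_abs_rsp_left[OF Quotient3_tensor] equivp_reflp[OF tensor_eq_equivp])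
  show "tensor_lift f (a \<otimes>\<^sub>C b) = f a b"
    by (simp add: pure_tensor.abs_eq lift_abs E_single)
  show "clinear (tensor_lift f)"
  proof (rule clinearI)
    fix t u :: "('a, 'b) tensor" and c
    obtain p q where "t = abs_tensor p" "u = abs_tensor q"
      using Quotient3_abs_rep[OF Quotient3_tensor] by metis
    then show "tensor_lift f (t + u) = tensor_lift f t + tensor_lift f u"
      "tensor_lift f (c *\<^sub>C t) = c *\<^sub>C tensor_lift f t"
      by (simp_all add: plus_tensor.abs_eq scaleC_tensor.abs_eq lift_abs E_add E_scale)
  qed
qed

lemma cbilinear_pure_tensor: "cbilinear (\<otimes>\<^sub>C)"
  unfolding cbilinear_def
  by (intro conjI allI clinearI; transfer;
      simp only: tensor_eq_def diff_diff_eq[symmetric]; rule cvec.span_base;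
      unfold tensor_relations_def; blast)

definition tensor_map ::
    "('a::complex_vector \<Rightarrow> 'c::complex_vector) \<Rightarrow> ('b::complex_vector \<Rightarrow> 'd::complex_vector)
      \<Rightarrow> ('a, 'b) tensor \<Rightarrow> ('c, 'd) tensor"
  where "tensor_map f g = tensor_lift (\<lambda>a b. f a \<otimes>\<^sub>C g b)"

definition tensor_assoc ::
    "(('a::complex_vector, 'b::complex_vector) tensor, 'c::complex_vector) tensor
      \<Rightarrow> ('a, ('b, 'c) tensor) tensor"
  where "tensor_assoc = tensor_lift (\<lambda>t c. tensor_lift (\<lambda>a b. a \<otimes>\<^sub>C (b \<otimes>\<^sub>C c)) t)"


section \<open>Graded algebras\<close>

definition homogeneous_decomposition ::
    "('g \<Rightarrow> 'a::complex_vector set) \<Rightarrow> 'a \<Rightarrow> ('g \<Rightarrow> 'a) \<Rightarrow> bool"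
  where "homogeneous_decomposition A x c \<longleftrightarrow>
    finite {\<alpha>. c \<alpha> \<noteq> 0} \<and> (\<forall>\<alpha>. c \<alpha> \<in> A \<alpha>) \<and> x = (\<Sum>\<alpha> | c \<alpha> \<noteq> 0. c \<alpha>)"

definition grading :: "('g \<Rightarrow> 'a::complex_vector set) \<Rightarrow> bool"
  where "grading A \<longleftrightarrow>
    (\<forall>\<alpha>. cvec.subspace (A \<alpha>)) \<and> (\<forall>x. \<exists>!c. homogeneous_decomposition A x c)"

definition component :: "('g \<Rightarrow> 'a::complex_vector set) \<Rightarrow> 'a \<Rightarrow> 'g \<Rightarrow> 'a"
  where "component A x = (THE c. homogeneous_decomposition A x c)"

definition graded_algebra :: "('g::ab_group_add \<Rightarrow> 'a::complex_algebra set) \<Rightarrow> bool"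
  where "graded_algebra A \<longleftrightarrow> grading A \<and> 1 \<in> A 0 \<and>
    (\<forall>\<alpha> \<beta>. \<forall>x\<in>A \<alpha>. \<forall>y\<in>A \<beta>. x * y \<in> A (\<alpha> + \<beta>))"

definition trivial_grading :: "'g::zero \<Rightarrow> 'a::zero set"
  where "trivial_grading \<alpha> = (if \<alpha> = 0 then UNIV else {0})"

definition commutative_factor :: "('g::ab_group_add \<Rightarrow> 'g \<Rightarrow> complex) \<Rightarrow> bool"
  where "commutative_factor \<omega> \<longleftrightarrow>
    (\<forall>\<alpha> \<beta>. \<omega> \<alpha> \<beta> \<noteq> 0) \<and>
    (\<forall>\<alpha> \<beta>. \<omega> \<alpha> \<beta> = inverse (\<omega> \<beta> \<alpha>)) \<and>
    (\<forall>\<alpha> \<beta> \<gamma>. \<omega> (\<alpha> + \<beta>) \<gamma> = \<omega> \<alpha> \<gamma> * \<omega> \<beta> \<gamma>) \<and>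
    (\<forall>\<alpha> \<beta> \<gamma>. \<omega> \<alpha> (\<beta> + \<gamma>) = \<omega> \<alpha> \<beta> * \<omega> \<alpha> \<gamma>)"

definition graded_commutative ::
    "('g \<Rightarrow> 'g \<Rightarrow> complex) \<Rightarrow> ('g \<Rightarrow> 'a::complex_algebra set) \<Rightarrow> bool"
  where "graded_commutative \<omega> A \<longleftrightarrow>
    (\<forall>\<alpha> \<beta>. \<forall>x\<in>A \<alpha>. \<forall>y\<in>A \<beta>. x * y = \<omega> \<alpha> \<beta> *\<^sub>C (y * x))"

text \<open>Multiplication, unit and grading are explicit arguments, since the multiplication of a
  tensor product depends on \<open>\<omega>\<close> and on the gradings and so is no type class operation.\<close>

definition graded_algebra_hom ::
    "('a::complex_vector \<Rightarrow> 'a \<Rightarrow> 'a) \<Rightarrow> 'a \<Rightarrow> ('g \<Rightarrow> 'a set) \<Rightarrow>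
     ('b::complex_vector \<Rightarrow> 'b \<Rightarrow> 'b) \<Rightarrow> 'b \<Rightarrow> ('g \<Rightarrow> 'b set) \<Rightarrow> ('a \<Rightarrow> 'b) \<Rightarrow> bool"
  where "graded_algebra_hom mult\<^sub>A one\<^sub>A A mult\<^sub>B one\<^sub>B B f \<longleftrightarrow>
    clinear f \<and> f one\<^sub>A = one\<^sub>B \<and> (\<forall>x y. f (mult\<^sub>A x y) = mult\<^sub>B (f x) (f y)) \<and>
    (\<forall>\<alpha>. \<forall>x\<in>A \<alpha>. f x \<in> B \<alpha>)"

definition algebra_homs ::
    "('g \<Rightarrow> 'a::complex_algebra set) \<Rightarrow> ('g \<Rightarrow> 'b::complex_algebra set) \<Rightarrow> ('a \<Rightarrow> 'b) set"
  where "algebra_homs A B = {f. graded_algebra_hom (*) 1 A (*) 1 B f}"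

definition tensor_grading ::
    "('g::ab_group_add \<Rightarrow> 'a::complex_vector set) \<Rightarrow> ('g \<Rightarrow> 'b::complex_vector set)
      \<Rightarrow> 'g \<Rightarrow> ('a, 'b) tensor set"
  where "tensor_grading A B \<gamma> =
    cvec.span {a \<otimes>\<^sub>C b | a b \<alpha> \<beta>. a \<in> A \<alpha> \<and> b \<in> B \<beta> \<and> \<alpha> + \<beta> = \<gamma>}"

text \<open>Bilinear extension of
  \<open>(a \<otimes> b) (a' \<otimes> b') = \<omega> (d b) (d a') (a a' \<otimes> b b')\<close> from homogeneous \<open>b\<close> and \<open>a'\<close>.\<close>

definition tensor_mult ::
    "('g \<Rightarrow> 'g \<Rightarrow> complex) \<Rightarrow> ('g \<Rightarrow> 'a::complex_algebra set) \<Rightarrow> ('g \<Rightarrow> 'b::complex_algebra set)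
      \<Rightarrow> ('a, 'b) tensor \<Rightarrow> ('a, 'b) tensor \<Rightarrow> ('a, 'b) tensor"
  where "tensor_mult \<omega> A B t u =
    tensor_lift (\<lambda>a b. tensor_lift (\<lambda>a' b'.
      \<Sum>\<beta> | component B b \<beta> \<noteq> 0. \<Sum>\<alpha> | component A a' \<alpha> \<noteq> 0.
        \<omega> \<beta> \<alpha> *\<^sub>C ((a * component A a' \<alpha>) \<otimes>\<^sub>C (component B b \<beta> * b'))) u) t"


lemma component_eqI:
  assumes "grading A" and "homogeneous_decomposition A x c"
  shows "component A x = c"
  using assms unfolding grading_def component_def by (metis the_equality)

lemma component_homogeneous:
  assumes "grading A" and "x \<in> A \<alpha>"
  shows "component A x = (\<lambda>\<beta>. if \<beta> = \<alpha> then x else 0)"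
proof (rule component_eqI[OF assms(1)])
  have "0 \<in> A \<beta>" for \<beta>
    using assms(1) by (simp add: grading_def cvec.subspace_0)
  moreover have "{\<beta>. (if \<beta> = \<alpha> then x else 0) \<noteq> 0} = (if x = 0 then {} else {\<alpha>})"
    by auto
  ultimately show "homogeneous_decomposition A x (\<lambda>\<beta>. if \<beta> = \<alpha> then x else 0)"
    using assms(2) by (auto simp: homogeneous_decomposition_def)
qed

lemma homogeneous_decomposition_component:
  assumes "grading A"
  shows "homogeneous_decomposition A x (component A x)"
  using assms component_eqI unfolding grading_def by metis

lemma component_add:
  assumes A: "grading A"
  shows "component A (x + y) \<alpha> = component A x \<alpha> + component A y \<alpha>"
proof -
  let ?x = "component A x" and ?y = "component A y"
  let ?K = "{\<alpha>. ?x \<alpha> \<noteq> 0} \<union> {\<alpha>. ?y \<alpha> \<noteq> 0}"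
  note dx = homogeneous_decomposition_component[OF A, of x, unfolded homogeneous_decomposition_def]
  note dy = homogeneous_decomposition_component[OF A, of y, unfolded homogeneous_decomposition_def]
  have fin: "finite ?K" using dx dy by auto
  have sub: "{\<alpha>. ?x \<alpha> + ?y \<alpha> \<noteq> 0} \<subseteq> ?K" by auto
  have "sum ?x {\<alpha>. ?x \<alpha> \<noteq> 0} = sum ?x ?K" "sum ?y {\<alpha>. ?y \<alpha> \<noteq> 0} = sum ?y ?K"
    using fin by (intro sum.mono_neutral_left; auto)+
  then have "sum ?x ?K = x" "sum ?y ?K = y"
    using dx dy by argo+
  then have "x + y = (\<Sum>\<alpha>\<in>?K. ?x \<alpha> + ?y \<alpha>)"
    by (simp only: sum.distrib)
  also have "\<dots> = (\<Sum>\<alpha> | ?x \<alpha> + ?y \<alpha> \<noteq> 0. ?x \<alpha> + ?y \<alpha>)"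
    using fin sub by (intro sum.mono_neutral_right) auto
  finally have "homogeneous_decomposition A (x + y) (\<lambda>\<alpha>. ?x \<alpha> + ?y \<alpha>)"
    using dx dy A finite_subset[OF sub fin]
    by (simp add: homogeneous_decomposition_def grading_def cvec.subspace_add)
  then show ?thesis using component_eqI[OF A] by metis
qed

lemma component_scaleC:
  assumes A: "grading A"
  shows "component A (c *\<^sub>C x) \<alpha> = c *\<^sub>C component A x \<alpha>"
proof -
  let ?x = "component A x"
  note dx = homogeneous_decomposition_component[OF A, of x, unfolded homogeneous_decomposition_def]
  have sub: "{\<alpha>. c *\<^sub>C ?x \<alpha> \<noteq> 0} \<subseteq> {\<alpha>. ?x \<alpha> \<noteq> 0}" by auto
  have "c *\<^sub>C x = (\<Sum>\<alpha> | ?x \<alpha> \<noteq> 0. c *\<^sub>C ?x \<alpha>)"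
    using dx cvec.scale_sum_right[of c ?x "{\<alpha>. ?x \<alpha> \<noteq> 0}"] by argo
  also have "\<dots> = (\<Sum>\<alpha> | c *\<^sub>C ?x \<alpha> \<noteq> 0. c *\<^sub>C ?x \<alpha>)"
    using dx sub by (intro sum.mono_neutral_right) auto
  finally have "homogeneous_decomposition A (c *\<^sub>C x) (\<lambda>\<alpha>. c *\<^sub>C ?x \<alpha>)"
    using dx A finite_subset[OF sub]
    by (simp add: homogeneous_decomposition_def grading_def cvec.subspace_scale)
  then show ?thesis using component_eqI[OF A] by metis
qed

lemma sum_component:
  fixes h :: "'g \<Rightarrow> 'a::complex_vector \<Rightarrow> 'b::complex_vector"
  assumes A: "grading A" and h: "\<And>\<alpha>. clinear (h \<alpha>)"
  shows "clinear (\<lambda>x. \<Sum>\<alpha> | component A x \<alpha> \<noteq> 0. h \<alpha> (component A x \<alpha>))"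
proof -
  have fin: "finite {\<alpha>. component A x \<alpha> \<noteq> 0}" for x
    using homogeneous_decomposition_component[OF A] by (auto simp: homogeneous_decomposition_def)
  have hadd: "h \<alpha> (x + y) = h \<alpha> x + h \<alpha> y" and hsc: "h \<alpha> (c *\<^sub>C x) = c *\<^sub>C h \<alpha> x" for \<alpha> x y c
    using h by (auto simp: Vector_Spaces.linear_iff)
  have h0: "h \<alpha> 0 = 0" for \<alpha>
    using hsc[of \<alpha> 0 0] by simp
  have eq: "(\<Sum>\<alpha> | component A x \<alpha> \<noteq> 0. h \<alpha> (component A x \<alpha>)) = (\<Sum>\<alpha>\<in>K. h \<alpha> (component A x \<alpha>))"
    if "finite K" "{\<alpha>. component A x \<alpha> \<noteq> 0} \<subseteq> K" for x K
    using that by (intro sum.mono_neutral_left) (auto simp: h0)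
  show ?thesis
  proof (rule clinearI)
    fix x y
    let ?K = "{\<alpha>. component A x \<alpha> \<noteq> 0} \<union> {\<alpha>. component A y \<alpha> \<noteq> 0}"
    have "{\<alpha>. component A (x + y) \<alpha> \<noteq> 0} \<subseteq> ?K" by (auto simp: component_add[OF A])
    then show "(\<Sum>\<alpha> | component A (x + y) \<alpha> \<noteq> 0. h \<alpha> (component A (x + y) \<alpha>)) =
        (\<Sum>\<alpha> | component A x \<alpha> \<noteq> 0. h \<alpha> (component A x \<alpha>)) +
        (\<Sum>\<alpha> | component A y \<alpha> \<noteq> 0. h \<alpha> (component A y \<alpha>))"
      using eq[of ?K x] eq[of ?K y] eq[of ?K "x + y"] fin
      by (simp add: component_add[OF A] hadd sum.distrib)
  next
    fix c x
    let ?K = "{\<alpha>. component A x \<alpha> \<noteq> 0}"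
    have "{\<alpha>. component A (c *\<^sub>C x) \<alpha> \<noteq> 0} \<subseteq> ?K" by (auto simp: component_scaleC[OF A])
    then show "(\<Sum>\<alpha> | component A (c *\<^sub>C x) \<alpha> \<noteq> 0. h \<alpha> (component A (c *\<^sub>C x) \<alpha>)) =
        c *\<^sub>C (\<Sum>\<alpha> | component A x \<alpha> \<noteq> 0. h \<alpha> (component A x \<alpha>))"
      using eq[of ?K "c *\<^sub>C x"] fin
      by (simp add: component_scaleC[OF A] hsc cvec.scale_sum_right)
  qed
qed

lemma clinear_iff:
  "clinear f \<longleftrightarrow> (\<forall>x y. f (x + y) = f x + f y) \<and> (\<forall>c x. f (c *\<^sub>C x) = c *\<^sub>C f x)"
  using clinearI[of f] by (auto simp: Vector_Spaces.linear_iff)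

lemma clinear_sum: "(\<And>i. i \<in> I \<Longrightarrow> clinear (f i)) \<Longrightarrow> clinear (\<lambda>x. \<Sum>i\<in>I. f i x)"
  by (simp add: clinear_iff sum.distrib cvec.scale_sum_right)

lemma clinear_tensor_lift_arg:
  assumes "\<And>b c. clinear (\<lambda>a. f a b c)"
  shows "clinear (\<lambda>a. tensor_lift (f a) t)"
  unfolding tensor_lift_def split_def
  by (rule clinear_sum) (use assms in \<open>simp add: clinear_iff scaleC_add_right scaleC_scaleC mult.commute\<close>)

lemma
  fixes A :: "'g \<Rightarrow> 'a::complex_algebra set" and B :: "'g \<Rightarrow> 'b::complex_algebra set"
  assumes A: "grading A" and B: "grading B"
  shows cbilinear_tensor_mult: "cbilinear (tensor_mult \<omega> A B)"
    and tensor_mult_pure: "\<lbrakk>b \<in> B \<beta>; a' \<in> A \<alpha>\<rbrakk> \<Longrightarrow>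
      tensor_mult \<omega> A B (a \<otimes>\<^sub>C b) (a' \<otimes>\<^sub>C b') = \<omega> \<beta> \<alpha> *\<^sub>C ((a * a') \<otimes>\<^sub>C (b * b'))"
proof -
  define M where "M a b a' b' =
      (\<Sum>\<beta> | component B b \<beta> \<noteq> 0. \<Sum>\<alpha> | component A a' \<alpha> \<noteq> 0.
        \<omega> \<beta> \<alpha> *\<^sub>C ((a * component A a' \<alpha>) \<otimes>\<^sub>C (component B b \<beta> * b')))" for a b a' b'
  note tensor_simps = cbilinearD[OF cbilinear_pure_tensor] scaleC_mult_left scaleC_mult_right
    distrib_left distrib_right scaleC_add_right scaleC_scaleC mult.commute[where 'a = complex]
  have "clinear (\<lambda>a. M a b a' b')" for b a' b'
    unfolding M_def by (intro clinear_sum) (simp add: clinear_iff tensor_simps)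
  moreover have "clinear (\<lambda>b. M a b a' b')" for a a' b'
    unfolding M_def
    by (intro sum_component[OF B] clinear_sum) (simp add: clinear_iff tensor_simps)
  ultimately have lin1: "clinear (\<lambda>a. tensor_lift (M a b) u)" "clinear (\<lambda>b. tensor_lift (M a b) u)"
    for a b u
    by (intro clinear_tensor_lift_arg; simp)+
  have M2: "cbilinear (M a b)" for a b
    unfolding cbilinear_def
  proof (intro conjI allI)
    show "clinear (\<lambda>a'. M a b a' b')" for b'
      unfolding M_def
      by (intro clinear_sum sum_component[OF A, where h = "\<lambda>\<alpha> x. _ \<alpha> *\<^sub>C ((a * x) \<otimes>\<^sub>C _)"])
        (simp add: clinear_iff tensor_simps)
    show "clinear (M a b a')" for a'
      unfolding M_def by (intro clinear_sum) (simp add: clinear_iff tensor_simps)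
  qed
  have M1: "cbilinear (\<lambda>a b. tensor_lift (M a b) u)" for u
    using lin1 by (simp add: cbilinear_def)
  have mult: "tensor_mult \<omega> A B t u = tensor_lift (\<lambda>a b. tensor_lift (M a b) u) t" for t u
    by (simp add: tensor_mult_def M_def[abs_def])
  show "cbilinear (tensor_mult \<omega> A B)"
    unfolding cbilinear_def mult
    by (auto intro!: clinear_tensor_lift[OF M1] clinear_tensor_lift_arg clinear_tensor_lift[OF M2])
  assume b: "b \<in> B \<beta>" and a': "a' \<in> A \<alpha>"
  have "tensor_mult \<omega> A B (a \<otimes>\<^sub>C b) (a' \<otimes>\<^sub>C b') = M a b a' b'"
    by (simp only: mult tensor_lift_pure[OF M1]) (rule tensor_lift_pure[OF M2])
  moreover have "{\<gamma>. component A a' \<gamma> \<noteq> 0} = (if a' = 0 then {} else {\<alpha>})" "component A a' \<alpha> = a'"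
    by (auto simp: component_homogeneous[OF A a'])
  moreover have "{\<gamma>. component B b \<gamma> \<noteq> 0} = (if b = 0 then {} else {\<beta>})" "component B b \<beta> = b"
    by (auto simp: component_homogeneous[OF B b])
  moreover have "x \<otimes>\<^sub>C (0::'b) = 0" "(0::'a) \<otimes>\<^sub>C y = 0" for x :: 'a and y :: 'b
    using cbilinearD(3)[OF cbilinear_pure_tensor, of 0 "0::'a" y]
      cbilinearD(4)[OF cbilinear_pure_tensor, of x 0 "0::'b"] by simp_all
  ultimately show "tensor_mult \<omega> A B (a \<otimes>\<^sub>C b) (a' \<otimes>\<^sub>C b') = \<omega> \<beta> \<alpha> *\<^sub>C ((a * a') \<otimes>\<^sub>C (b * b'))"
    by (simp add: M_def)
qed

section \<open>Hopf algebras and their points\<close>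

locale hopf_algebra =
  fixes \<omega> :: "'g::ab_group_add \<Rightarrow> 'g \<Rightarrow> complex"
    and H :: "'g \<Rightarrow> 'h::complex_algebra set"
    and \<Delta> :: "'h \<Rightarrow> ('h, 'h) tensor"
    and \<epsilon> :: "'h \<Rightarrow> complex"
    and S :: "'h \<Rightarrow> 'h"
  assumes factor: "commutative_factor \<omega>"
    and graded: "graded_algebra H"
    and comult_hom: "graded_algebra_hom (*) 1 H
          (tensor_mult \<omega> H H) (1 \<otimes>\<^sub>C 1) (tensor_grading H H) \<Delta>"
    and counit_hom: "graded_algebra_hom (*) 1 H (*) 1 trivial_grading \<epsilon>"
    and coassoc: "tensor_assoc (tensor_map \<Delta> id (\<Delta> x)) = tensor_map id \<Delta> (\<Delta> x)"
    and counit_left: "tensor_lift (\<lambda>a b. \<epsilon> a *\<^sub>C b) (\<Delta> x) = x"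
    and counit_right: "tensor_lift (\<lambda>a b. \<epsilon> b *\<^sub>C a) (\<Delta> x) = x"
    and antipode_linear: "clinear S"
    and antipode_degree: "x \<in> H \<alpha> \<Longrightarrow> S x \<in> H \<alpha>"
    and antipode_mult: "\<lbrakk>x \<in> H \<alpha>; y \<in> H \<beta>\<rbrakk> \<Longrightarrow> S (x * y) = \<omega> \<alpha> \<beta> *\<^sub>C (S y * S x)"
    and antipode_left: "tensor_lift (\<lambda>a b. S a * b) (\<Delta> x) = \<epsilon> x *\<^sub>C 1"
    and antipode_right: "tensor_lift (\<lambda>a b. a * S b) (\<Delta> x) = \<epsilon> x *\<^sub>C 1"

definition test_algebra ::
    "('g::ab_group_add \<Rightarrow> 'g \<Rightarrow> complex) \<Rightarrow> ('g \<Rightarrow> 'r::complex_algebra set) \<Rightarrow> bool"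
  where "test_algebra \<omega> R \<longleftrightarrow>
    graded_algebra R \<and> graded_commutative \<omega> R \<and> finitely_generated_algebra TYPE('r)"

definition convolution ::
    "('h::complex_vector \<Rightarrow> ('h, 'h) tensor) \<Rightarrow> ('h \<Rightarrow> 'r::complex_algebra) \<Rightarrow> ('h \<Rightarrow> 'r) \<Rightarrow> 'h \<Rightarrow> 'r"
  where "convolution \<Delta> \<phi> \<psi> f = tensor_lift (\<lambda>a b. \<phi> a * \<psi> b) (\<Delta> f)"

definition point_group ::
    "('g \<Rightarrow> 'h::complex_algebra set) \<Rightarrow> ('h \<Rightarrow> ('h, 'h) tensor) \<Rightarrow> ('h \<Rightarrow> complex)
      \<Rightarrow> ('g \<Rightarrow> 'r::complex_algebra set) \<Rightarrow> ('h \<Rightarrow> 'r) monoid"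
  where "point_group H \<Delta> \<epsilon> R =
    \<lparr>carrier = algebra_homs H R, monoid.mult = convolution \<Delta>, one = (\<lambda>f. \<epsilon> f *\<^sub>C 1)\<rparr>"

definition point_map :: "('r \<Rightarrow> 's) \<Rightarrow> ('h \<Rightarrow> 'r) \<Rightarrow> 'h \<Rightarrow> 's"
  where "point_map \<theta> \<phi> = \<theta> \<circ> \<phi>"

end

theory Submission
  imports Defs
begin

text \<open>For graded commutative \<open>R\<close> the map \<open>a \<otimes> b \<mapsto> \<phi> a * \<psi> b\<close> is an algebra homomorphism
  on the tensor square of \<open>H\<close>: the factor \<open>\<omega> (d b) (d a')\<close> of the tensor multiplication cancels
  against the one from exchanging \<open>\<psi> b\<close> and \<open>\<phi> a'\<close>. Composing with \<open>\<Delta>\<close> shows that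
  the convolution of two points is a point. Likewise the antipode of a graded commutative \<open>H\<close> is
  multiplicative, so it acts on points. The group axioms are the Hopf axioms pushed through linear
  maps on tensor products, which are determined by their values on pure tensors.\<close>

section \<open>Linear and bilinear maps on tensor products and graded spaces\<close>

lemma clinear_zero: "clinear f \<Longrightarrow> f 0 = 0"
  by (metis clinear_iff cvec.scale_zero_left)

lemma clinear_compose:
  assumes "clinear f" "clinear g"
  shows "clinear (\<lambda>x. f (g x))"
  using assms by (simp add: clinear_iff)

lemma cbilinearI:
  assumes "\<And>a. clinear (f a)" "\<And>b. clinear (\<lambda>a. f a b)"
  shows "cbilinear f"
  using assms by (simp add: cbilinear_def)

lemma cbilinear_linear_arg:
  assumes "cbilinear f"
  shows "clinear (f a)" "clinear (\<lambda>a. f a b)"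
  using assms by (simp_all add: cbilinear_def)

lemma subspace_clinear_eq:
  assumes "clinear f" "clinear g"
  shows "cvec.subspace {x. f x = g x}"
  using assms clinear_zero[of f] clinear_zero[of g]
  by (simp add: cvec.subspace_def clinear_iff)

text \<open>Induction over a representative, built up one key at a time: each new key
  \<open>(a, b)\<close> with coefficient \<open>c\<close> contributes a multiple of one pure
  tensor.\<close>

lemma span_pure_tensors: "t \<in> cvec.span {a \<otimes>\<^sub>C b | a b. True}"
proof -
  have "abs_tensor p \<in> cvec.span {a \<otimes>\<^sub>C b | a b. True}" for p :: "'a \<times> 'b \<Rightarrow>\<^sub>0 complex"
  proof (induction p rule: update_induct)
    case const
    then show ?case
      by (simp add: zero_tensor.abs_eq[symmetric] cvec.span_zero)
  next
    case (update p k c)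
    \<comment> \<open>The induction only updates keys that are absent from \<open>p\<close>, so the
      update is the addition of a \<open>single\<close>.\<close>
    have split: "Poly_Mapping.update k c p = Poly_Mapping.single k c + p"
      using update.hyps(1)
      by (intro poly_mapping_eqI)
        (auto simp: lookup_update lookup_add lookup_single when_def not_in_keys_iff_lookup_eq_zero)
    obtain a b where k: "k = (a, b)" by force
    have "Poly_Mapping.single k c = c *\<^sub>C Poly_Mapping.single (a, b) 1"
      by (rule poly_mapping_eqI)
        (simp add: k lookup_scaleC scaleC_complex_def lookup_single when_def)
    then have "abs_tensor (Poly_Mapping.single k c) = c *\<^sub>C (a \<otimes>\<^sub>C b)"
      by (simp add: scaleC_tensor.abs_eq pure_tensor.abs_eq)
    then have "abs_tensor (Poly_Mapping.single k c) \<in> cvec.span {a \<otimes>\<^sub>C b | a b. True}"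
      by (simp only:) (rule cvec.span_scale[OF cvec.span_base], blast)
    with update.IH show ?case
      by (simp add: split plus_tensor.abs_eq[symmetric] cvec.span_add)
  qed
  then show ?thesis
    by (metis Quotient3_abs_rep[OF Quotient3_tensor])
qed

text \<open>The equalizer of two linear maps is a subspace, so containing the pure tensors it
  contains their span, which is everything.\<close>

lemma clinear_tensor_eqI:
  assumes "clinear F" "clinear G" "\<And>a b. F (a \<otimes>\<^sub>C b) = G (a \<otimes>\<^sub>C b)"
  shows "F t = G t"
  by (rule cvec.span_induct[OF span_pure_tensors subspace_clinear_eq[OF assms(1,2)]])
    (use assms(3) in auto)

text \<open>Both sides are linear in \<open>t\<close> and agree on pure tensors. This is the tool
  for pushing the counit and antipode axioms through a point.\<close>

lemma clinear_tensor_lift_comp: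
  assumes F: "clinear F" and f: "cbilinear f"
  shows "F (tensor_lift f t) = tensor_lift (\<lambda>a b. F (f a b)) t"
proof -
  have Ff: "cbilinear (\<lambda>a b. F (f a b))"
    by (intro cbilinearI clinear_compose[OF F] cbilinear_linear_arg[OF f])
  show ?thesis
    by (rule clinear_tensor_eqI)
      (simp_all add: clinear_compose[OF F] clinear_tensor_lift f Ff tensor_lift_pure)
qed

text \<open>Coassociativity is stated with \<open>tensor_map\<close>; this evaluates both of its
  sides under a lift.\<close>

lemma tensor_lift_tensor_map:
  assumes h: "cbilinear h" and f: "clinear f" and g: "clinear g"
  shows "tensor_lift h (tensor_map f g t) = tensor_lift (\<lambda>a b. h (f a) (g b)) t"
proof -
  have "cbilinear (\<lambda>a b. f a \<otimes>\<^sub>C g b)"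
    using f g by (intro cbilinearI) (simp_all add: clinear_iff cbilinearD[OF cbilinear_pure_tensor])
  from clinear_tensor_lift_comp[OF clinear_tensor_lift[OF h] this] show ?thesis
    by (simp add: tensor_map_def tensor_lift_pure[OF h])
qed

text \<open>Each element is a finite sum of homogeneous components, and the equalizer is a subspace.
  It extends formulas involving \<omega>, available only in homogeneous degrees, to all
  elements.\<close>

lemma clinear_homogeneous_eqI:
  assumes A: "grading A" and lin: "clinear f" "clinear g"
    and eq: "\<And>\<alpha> x. x \<in> A \<alpha> \<Longrightarrow> f x = g x"
  shows "f x = g x"
proof -
  have sub: "cvec.subspace {x. f x = g x}" by (rule subspace_clinear_eq[OF lin])
  have "homogeneous_decomposition A x (component A x)"
    by (rule homogeneous_decomposition_component[OF A])
  then have "x = (\<Sum>\<alpha> | component A x \<alpha> \<noteq> 0. component A x \<alpha>)"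
    and "\<And>\<alpha>. component A x \<alpha> \<in> {x. f x = g x}"
    using eq by (auto simp: homogeneous_decomposition_def)
  then have "x \<in> {x. f x = g x}"
    by (metis (no_types, lifting) cvec.subspace_sum[OF sub])
  then show ?thesis by simp
qed

lemma cbilinear_homogeneous_eqI:
  assumes A: "grading A" and B: "grading B" and bil: "cbilinear f" "cbilinear g"
    and eq: "\<And>\<alpha> \<beta> x y. x \<in> A \<alpha> \<Longrightarrow> y \<in> B \<beta> \<Longrightarrow> f x y = g x y"
  shows "f x y = g x y"
\<comment> \<open>One argument is reduced at a time, with the other held fixed.\<close>
proof (rule clinear_homogeneous_eqI[OF A, where x = x])
  fix \<alpha> x assume x: "x \<in> A \<alpha>"
  show "f x y = g x y"
    by (rule clinear_homogeneous_eqI[OF B, where x = y])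
      (use x eq cbilinear_linear_arg[OF bil(1)] cbilinear_linear_arg[OF bil(2)] in auto)
qed (use cbilinear_linear_arg[OF bil(1)] cbilinear_linear_arg[OF bil(2)] in auto)

lemma cbilinear_mult_compose:
  fixes f :: "'a::complex_vector \<Rightarrow> 'c::complex_algebra" and g :: "'b::complex_vector \<Rightarrow> 'c"
  assumes "clinear f" "clinear g"
  shows "cbilinear (\<lambda>a b. f a * g b)"
  using assms
  by (intro cbilinearI)
    (simp_all add: clinear_iff distrib_left distrib_right scaleC_mult_left scaleC_mult_right)

section \<open>Graded homomorphisms and the product map on a tensor product\<close>

lemma algebra_homsD:
  assumes "\<phi> \<in> algebra_homs A B"
  shows "clinear \<phi>" "\<phi> 1 = 1" "\<phi> (x * y) = \<phi> x * \<phi> y" "x \<in> A \<alpha> \<Longrightarrow> \<phi> x \<in> B \<alpha>"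
  using assms by (auto simp: algebra_homs_def graded_algebra_hom_def)

lemma algebra_homsI:
  assumes "clinear \<phi>" "\<phi> 1 = 1" "\<And>x y. \<phi> (x * y) = \<phi> x * \<phi> y"
    "\<And>\<alpha> x. x \<in> A \<alpha> \<Longrightarrow> \<phi> x \<in> B \<alpha>"
  shows "\<phi> \<in> algebra_homs A B"
  using assms by (auto simp: algebra_homs_def graded_algebra_hom_def)

lemma algebra_homs_compose:
  assumes "\<phi> \<in> algebra_homs A B" "\<theta> \<in> algebra_homs B C"
  shows "\<theta> \<circ> \<phi> \<in> algebra_homs A C"
  using assms by (auto intro!: algebra_homsI simp: algebra_homsD clinear_compose comp_def)

lemma commutative_factor_inverse:
  assumes "commutative_factor \<omega>"
  shows "\<omega> \<alpha> \<beta> * \<omega> \<beta> \<alpha> = 1"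
proof -
  have "\<omega> \<alpha> \<beta> = inverse (\<omega> \<beta> \<alpha>)" "\<omega> \<beta> \<alpha> \<noteq> 0"
    using assms unfolding commutative_factor_def by blast+
  then show ?thesis by simp
qed

lemma tensor_lift_tensor_mult:
  fixes \<phi> :: "'a::complex_algebra \<Rightarrow> 'r::complex_algebra" and \<psi> :: "'b::complex_algebra \<Rightarrow> 'r"
  assumes \<omega>: "commutative_factor \<omega>" and A: "grading A" and B: "grading B"
    and R: "graded_commutative \<omega> R"
    and \<phi>: "\<phi> \<in> algebra_homs A R" and \<psi>: "\<psi> \<in> algebra_homs B R"
  shows "tensor_lift (\<lambda>a b. \<phi> a * \<psi> b) (tensor_mult \<omega> A B t u) =
    tensor_lift (\<lambda>a b. \<phi> a * \<psi> b) t * tensor_lift (\<lambda>a b. \<phi> a * \<psi> b) u"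
proof -
  let ?m = "tensor_lift (\<lambda>a b. \<phi> a * \<psi> b)"
  have M: "cbilinear (\<lambda>a b. \<phi> a * \<psi> b)"
    by (rule cbilinear_mult_compose[OF algebra_homsD(1)[OF \<phi>] algebra_homsD(1)[OF \<psi>]])
  note lin = clinear_tensor_lift[OF M]
  note T = cbilinear_tensor_mult[OF A B, of \<omega>]
  note lin' = lin[unfolded clinear_iff] algebra_homsD(1)[OF \<phi>, unfolded clinear_iff]
    algebra_homsD(1)[OF \<psi>, unfolded clinear_iff]
  note simps = lin' cbilinearD[OF T] cbilinearD[OF cbilinear_pure_tensor]
    distrib_left distrib_right scaleC_mult_left scaleC_mult_right
  \<comment> \<open>With the outer factors \<open>a\<close> and \<open>b'\<close> fixed, both sides
    are bilinear in \<open>b\<close> and \<open>a'\<close>, the factors that the tensor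
    multiplication exchanges. So these two may be taken homogeneous, and
    \<open>tensor_mult_pure\<close> applies.\<close>
  have pure: "?m (tensor_mult \<omega> A B (a \<otimes>\<^sub>C b) (a' \<otimes>\<^sub>C b')) = ?m (a \<otimes>\<^sub>C b) * ?m (a' \<otimes>\<^sub>C b')"
    for a b a' b'
  proof (rule cbilinear_homogeneous_eqI[OF B A, where x = b and y = a'])
    fix \<beta> \<alpha> b a'
    assume b: "b \<in> B \<beta>" and a': "a' \<in> A \<alpha>"
    \<comment> \<open>Homomorphisms have degree 0, so \<phi> and \<psi> keep the degrees \<alpha>
      and \<beta> and the exchange in \<open>R\<close> costs exactly the factor inverse to \<omega>
      \<beta> \<alpha>.\<close>
    have "\<phi> a' * \<psi> b = \<omega> \<alpha> \<beta> *\<^sub>C (\<psi> b * \<phi> a')"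
      using R algebra_homsD(4)[OF \<phi> a'] algebra_homsD(4)[OF \<psi> b]
      unfolding graded_commutative_def by blast
    then have "\<omega> \<beta> \<alpha> *\<^sub>C (\<phi> a * (\<phi> a' * \<psi> b) * \<psi> b') = \<phi> a * (\<psi> b * \<phi> a') * \<psi> b'"
      by (simp only: scaleC_mult_left scaleC_mult_right scaleC_scaleC
          commutative_factor_inverse[OF \<omega>] scaleC_one)
    then show "?m (tensor_mult \<omega> A B (a \<otimes>\<^sub>C b) (a' \<otimes>\<^sub>C b')) = ?m (a \<otimes>\<^sub>C b) * ?m (a' \<otimes>\<^sub>C b')"
      by (simp add: tensor_mult_pure[OF A B b a'] lin' tensor_lift_pure[OF M]
          algebra_homsD(3)[OF \<phi>] algebra_homsD(3)[OF \<psi>] mult.assoc)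
  qed (rule cbilinearI; simp add: clinear_iff simps)+
  show ?thesis
  \<comment> \<open>Linear extension from pure tensors, first in \<open>t\<close>, then in
    \<open>u\<close>.\<close>
  proof (rule clinear_tensor_eqI[where t = t])
    fix a b
    show "?m (tensor_mult \<omega> A B (a \<otimes>\<^sub>C b) u) = ?m (a \<otimes>\<^sub>C b) * ?m u"
      by (rule clinear_tensor_eqI[where t = u]) (simp_all add: clinear_iff simps pure)
  qed (simp_all add: clinear_iff simps)
qed

lemma subspace_graded_algebra: "graded_algebra A \<Longrightarrow> cvec.subspace (A \<alpha>)"
  by (simp add: graded_algebra_def grading_def)

text \<open>The preimage of the subspace \<open>C \<gamma>\<close> under the lift is a subspace
  containing the generators of \<open>tensor_grading A B \<gamma>\<close>. It gives degree
  preservation of convolutions.\<close>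

lemma tensor_lift_tensor_grading:
  assumes f: "cbilinear f" and C: "cvec.subspace (C \<gamma>)"
    and deg: "\<And>\<alpha> \<beta> a b. a \<in> A \<alpha> \<Longrightarrow> b \<in> B \<beta> \<Longrightarrow> f a b \<in> C (\<alpha> + \<beta>)"
    and t: "t \<in> tensor_grading A B \<gamma>"
  shows "tensor_lift f t \<in> C \<gamma>"
proof -
  have lin: "clinear (tensor_lift f)" by (rule clinear_tensor_lift[OF f])
  have "cvec.subspace {t. tensor_lift f t \<in> C \<gamma>}"
    using C clinear_zero[OF lin] lin by (simp add: cvec.subspace_def clinear_iff)
  then show ?thesis
    by (rule cvec.span_induct[OF t[unfolded tensor_grading_def]])
      (use deg in \<open>auto simp: tensor_lift_pure[OF f]\<close>)
qed

section \<open>Structure maps of the Hopf algebra and the points they produce\<close>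

context hopf_algebra
begin

lemma grading_H: "grading H"
  using graded by (simp add: graded_algebra_def)

lemma comult:
  shows clinear_comult: "clinear \<Delta>"
    and comult_one: "\<Delta> 1 = 1 \<otimes>\<^sub>C 1"
    and comult_mult: "\<Delta> (x * y) = tensor_mult \<omega> H H (\<Delta> x) (\<Delta> y)"
    and comult_degree: "x \<in> H \<alpha> \<Longrightarrow> \<Delta> x \<in> tensor_grading H H \<alpha>"
  using comult_hom by (simp_all add: graded_algebra_hom_def)

lemma counit:
  shows clinear_counit: "clinear \<epsilon>"
    and counit_one: "\<epsilon> 1 = 1"
    and counit_mult: "\<epsilon> (x * y) = \<epsilon> x * \<epsilon> y"
    and counit_degree: "x \<in> H \<alpha> \<Longrightarrow> \<alpha> \<noteq> 0 \<Longrightarrow> \<epsilon> x = 0"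
  using counit_hom by (auto simp: graded_algebra_hom_def trivial_grading_def) fastforce

lemma counit_in_algebra_homs:
  assumes R: "graded_algebra R"
  shows "(\<lambda>f. \<epsilon> f *\<^sub>C 1) \<in> algebra_homs H R"
proof (rule algebra_homsI)
  \<comment> \<open>In degree 0 the value is a multiple of 1, which lies in \<open>R 0\<close>; in
    every other degree the counit vanishes.\<close>
  fix \<alpha> x assume "x \<in> H \<alpha>"
  then show "\<epsilon> x *\<^sub>C 1 \<in> R \<alpha>"
    using R counit_degree[of x \<alpha>] cvec.subspace_0[OF subspace_graded_algebra[OF R]]
    by (cases "\<alpha> = 0") (auto intro: cvec.subspace_scale[OF subspace_graded_algebra[OF R]]
        simp: graded_algebra_def)
qed (use clinear_counit in \<open>simp_all add: clinear_iff counit_one counit_mult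
    scaleC_one scaleC_add_left scaleC_scaleC scaleC_complex_def scaleC_mult_left scaleC_mult_right\<close>)

lemma convolution_in_algebra_homs:
  assumes R: "graded_algebra R" "graded_commutative \<omega> R"
    and \<phi>: "\<phi> \<in> algebra_homs H R" and \<psi>: "\<psi> \<in> algebra_homs H R"
  shows "convolution \<Delta> \<phi> \<psi> \<in> algebra_homs H R"
proof -
  have M: "cbilinear (\<lambda>a b. \<phi> a * \<psi> b)"
    by (rule cbilinear_mult_compose[OF algebra_homsD(1)[OF \<phi>] algebra_homsD(1)[OF \<psi>]])
  show ?thesis
    unfolding convolution_def[abs_def]
  proof (rule algebra_homsI)
    show "clinear (\<lambda>f. tensor_lift (\<lambda>a b. \<phi> a * \<psi> b) (\<Delta> f))"
      by (rule clinear_compose[OF clinear_tensor_lift[OF M] clinear_comult])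
    show "tensor_lift (\<lambda>a b. \<phi> a * \<psi> b) (\<Delta> 1) = 1"
      by (simp add: comult_one tensor_lift_pure[OF M] algebra_homsD(2)[OF \<phi>] algebra_homsD(2)[OF \<psi>])
    show "tensor_lift (\<lambda>a b. \<phi> a * \<psi> b) (\<Delta> (x * y)) =
        tensor_lift (\<lambda>a b. \<phi> a * \<psi> b) (\<Delta> x) * tensor_lift (\<lambda>a b. \<phi> a * \<psi> b) (\<Delta> y)" for x y
      by (simp add: comult_mult tensor_lift_tensor_mult[OF factor grading_H grading_H R(2) \<phi> \<psi>])
    show "tensor_lift (\<lambda>a b. \<phi> a * \<psi> b) (\<Delta> x) \<in> R \<alpha>" if "x \<in> H \<alpha>" for \<alpha> x
      by (rule tensor_lift_tensor_grading[where A = H and B = H and C = R, OF M _ _ comult_degree[OF that]])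
        (use R(1) algebra_homsD(4)[OF \<phi>] algebra_homsD(4)[OF \<psi>] in
          \<open>auto simp: graded_algebra_def subspace_graded_algebra[OF R(1)]\<close>)
  qed
qed

lemma antipode_mult_commutative:
  assumes "graded_commutative \<omega> H"
  shows "S (x * y) = S x * S y"
proof (rule cbilinear_homogeneous_eqI[OF grading_H grading_H, where x = x and y = y])
  fix \<alpha> \<beta> x y assume x: "x \<in> H \<alpha>" and y: "y \<in> H \<beta>"
  \<comment> \<open>The antipode preserves degrees, so restoring the order of the two factors
    cancels the \<omega> \<alpha> \<beta> of \<open>antipode_mult\<close>.\<close>
  have "S y * S x = \<omega> \<beta> \<alpha> *\<^sub>C (S x * S y)"
    using assms antipode_degree[OF x] antipode_degree[OF y]
    unfolding graded_commutative_def by blast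
  then show "S (x * y) = S x * S y"
    by (simp add: antipode_mult[OF x y] scaleC_scaleC commutative_factor_inverse[OF factor] scaleC_one)
next
  show "cbilinear (\<lambda>x y. S (x * y))"
    using antipode_linear
    by (intro cbilinearI)
      (simp_all add: clinear_iff distrib_left distrib_right scaleC_mult_left scaleC_mult_right)
qed (rule cbilinear_mult_compose[OF antipode_linear antipode_linear])

text \<open>Since \<Delta> 1 = 1 \<otimes> 1, the left antipode axiom at 1 reads S 1 * 1 =
  1.\<close>

lemma antipode_one: "S 1 = 1"
proof -
  have "cbilinear (\<lambda>a b. S a * id b)"
    by (rule cbilinear_mult_compose[OF antipode_linear]) (simp add: clinear_iff)
  from tensor_lift_pure[OF this, of 1 1] antipode_left[of 1] show ?thesis
    by (simp add: comult_one counit_one scaleC_one)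
qed

lemma antipode_in_algebra_homs:
  assumes "graded_commutative \<omega> H"
  shows "S \<in> algebra_homs H H"
  by (rule algebra_homsI)
    (simp_all add: antipode_linear antipode_one antipode_mult_commutative[OF assms] antipode_degree)

section \<open>Group laws for convolution\<close>

lemma convolution_assoc:
  fixes \<phi> :: "'h \<Rightarrow> 'r::complex_algebra"
  assumes lin: "clinear \<phi>" "clinear \<psi>" "clinear \<chi>"
  shows "convolution \<Delta> (convolution \<Delta> \<phi> \<psi>) \<chi> = convolution \<Delta> \<phi> (convolution \<Delta> \<psi> \<chi>)"
proof
  fix f
  \<comment> \<open>\<open>?p\<close> and \<open>?q\<close> multiply out two factors;
    \<open>?T\<close> is the right-nested triple product on H \<otimes> (H \<otimes> H).\<close>
  let ?p = "tensor_lift (\<lambda>a b. \<phi> a * \<psi> b)" and ?q = "tensor_lift (\<lambda>b c. \<psi> b * \<chi> c)"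
  let ?T = "tensor_lift (\<lambda>a t. \<phi> a * ?q t)"
  have P: "cbilinear (\<lambda>a b. \<phi> a * \<psi> b)" and Q: "cbilinear (\<lambda>b c. \<psi> b * \<chi> c)"
    by (intro cbilinear_mult_compose lin)+
  note p = clinear_tensor_lift[OF P] and q = clinear_tensor_lift[OF Q]
  have T: "cbilinear (\<lambda>a t. \<phi> a * ?q t)"
    by (rule cbilinear_mult_compose[OF lin(1) q])
  note pure = cbilinearD[OF cbilinear_pure_tensor]
  \<comment> \<open>The two nested lifts in \<open>tensor_assoc\<close> come from bilinear maps, so
    they can be evaluated on pure tensors and linear maps move inside them.\<close>
  have a1: "cbilinear (\<lambda>(a :: 'h) (b :: 'h). a \<otimes>\<^sub>C (b \<otimes>\<^sub>C c))" for c :: 'h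
    by (rule cbilinearI) (simp_all add: clinear_iff pure)
  have a2: "cbilinear (\<lambda>(t :: ('h, 'h) tensor) (c :: 'h). tensor_lift (\<lambda>a b. a \<otimes>\<^sub>C (b \<otimes>\<^sub>C c)) t)"
    by (intro cbilinearI clinear_tensor_lift[OF a1] clinear_tensor_lift_arg)
      (simp add: clinear_iff pure)
  \<comment> \<open>Reassociating and then applying \<open>?T\<close> is the left-nested triple
    product: on pure tensors this is associativity of the target algebra.\<close>
  have assoc: "?T (tensor_assoc t) = tensor_lift (\<lambda>t c. ?p t * \<chi> c) t" for t
  proof -
    have "?T (tensor_lift (\<lambda>a b. a \<otimes>\<^sub>C (b \<otimes>\<^sub>C c)) t) = ?p t * \<chi> c" for t c
    proof (rule clinear_tensor_eqI[where t = t])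
      show "clinear (\<lambda>t. ?T (tensor_lift (\<lambda>a b. a \<otimes>\<^sub>C (b \<otimes>\<^sub>C c)) t))"
        by (rule clinear_compose[OF clinear_tensor_lift[OF T] clinear_tensor_lift[OF a1]])
      show "clinear (\<lambda>t. ?p t * \<chi> c)"
        by (rule cbilinear_linear_arg(2)[OF cbilinear_mult_compose[OF p lin(3)]])
    qed (simp add: tensor_lift_pure[OF a1] tensor_lift_pure[OF T] tensor_lift_pure[OF P]
        tensor_lift_pure[OF Q] mult.assoc)
    then show ?thesis
      by (simp add: tensor_assoc_def clinear_tensor_lift_comp[OF clinear_tensor_lift[OF T] a2])
  qed
  have id: "clinear (id :: 'h \<Rightarrow> 'h)" by (simp add: clinear_iff)
  \<comment> \<open>The inserted \<open>id\<close> gives the integrand the shape produced by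
    \<open>tensor_map \<Delta> id\<close>.\<close>
  have "convolution \<Delta> (convolution \<Delta> \<phi> \<psi>) \<chi> f = tensor_lift (\<lambda>a c. ?p (\<Delta> a) * \<chi> (id c)) (\<Delta> f)"
    by (simp add: convolution_def)
  also have "\<dots> = ?T (tensor_assoc (tensor_map \<Delta> id (\<Delta> f)))"
    by (simp only: assoc tensor_lift_tensor_map[OF cbilinear_mult_compose[OF p lin(3)] clinear_comult id])
  also have "\<dots> = convolution \<Delta> \<phi> (convolution \<Delta> \<psi> \<chi>) f"
    by (simp add: coassoc tensor_lift_tensor_map[OF T id clinear_comult] convolution_def)
  finally show "convolution \<Delta> (convolution \<Delta> \<phi> \<psi>) \<chi> f = convolution \<Delta> \<phi> (convolution \<Delta> \<psi> \<chi>) f" .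
qed

lemma counit_convolution:
  fixes \<phi> :: "'h \<Rightarrow> 'r::complex_algebra"
  assumes \<phi>: "clinear \<phi>"
  shows "convolution \<Delta> (\<lambda>f. \<epsilon> f *\<^sub>C 1) \<phi> = \<phi>"
proof
  fix f
  have b: "cbilinear (\<lambda>a b. \<epsilon> a *\<^sub>C (b :: 'h))"
    using clinear_counit
    by (intro cbilinearI) (simp_all add: clinear_iff scaleC_add_left scaleC_add_right scaleC_scaleC
        scaleC_complex_def mult.commute)
  \<comment> \<open>Linearity moves the scalar \<epsilon> a inside \<phi>; then \<phi> leaves the
    lift and \<open>counit_left\<close> remains.\<close>
  have "convolution \<Delta> (\<lambda>f. \<epsilon> f *\<^sub>C 1) \<phi> f = tensor_lift (\<lambda>a b. \<phi> (\<epsilon> a *\<^sub>C b)) (\<Delta> f)"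
    using \<phi> by (simp add: convolution_def clinear_iff scaleC_mult_left)
  also have "\<dots> = \<phi> f"
    by (simp only: clinear_tensor_lift_comp[OF \<phi> b, symmetric] counit_left)
  finally show "convolution \<Delta> (\<lambda>f. \<epsilon> f *\<^sub>C 1) \<phi> f = \<phi> f" .
qed

text \<open>As \<phi> is multiplicative, \<phi> (S a) * \<phi> b = \<phi> (S a * b), so \<phi>
  leaves the lift and is applied to the left antipode identity.\<close>

lemma antipode_convolution:
  fixes \<phi> :: "'h \<Rightarrow> 'r::complex_algebra"
  assumes \<phi>: "\<phi> \<in> algebra_homs H R"
  shows "convolution \<Delta> (\<lambda>f. \<phi> (S f)) \<phi> = (\<lambda>f. \<epsilon> f *\<^sub>C 1)"
proof
  fix f
  note lin = algebra_homsD(1)[OF \<phi>]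
  have b: "cbilinear (\<lambda>a b. S a * id b)"
    by (rule cbilinear_mult_compose[OF antipode_linear]) (simp add: clinear_iff)
  have "convolution \<Delta> (\<lambda>f. \<phi> (S f)) \<phi> f = \<phi> (tensor_lift (\<lambda>a b. S a * b) (\<Delta> f))"
    using clinear_tensor_lift_comp[OF lin b] by (simp add: convolution_def algebra_homsD(3)[OF \<phi>])
  also have "\<dots> = \<epsilon> f *\<^sub>C 1"
    using lin by (simp add: antipode_left clinear_iff algebra_homsD(2)[OF \<phi>])
  finally show "convolution \<Delta> (\<lambda>f. \<phi> (S f)) \<phi> f = \<epsilon> f *\<^sub>C 1" .
qed

section \<open>Naturality and the group of points\<close>

lemma point_map_convolution:
  assumes \<phi>: "\<phi> \<in> algebra_homs H R" and \<psi>: "\<psi> \<in> algebra_homs H R"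
    and \<theta>: "\<theta> \<in> algebra_homs R R'"
  shows "point_map \<theta> (convolution \<Delta> \<phi> \<psi>) = convolution \<Delta> (point_map \<theta> \<phi>) (point_map \<theta> \<psi>)"
proof
  fix f
  have "cbilinear (\<lambda>a b. \<phi> a * \<psi> b)"
    by (rule cbilinear_mult_compose[OF algebra_homsD(1)[OF \<phi>] algebra_homsD(1)[OF \<psi>]])
  \<comment> \<open>Linearity carries \<theta> inside the lift, where multiplicativity splits it
    over the two factors.\<close>
  from clinear_tensor_lift_comp[OF algebra_homsD(1)[OF \<theta>] this]
  show "point_map \<theta> (convolution \<Delta> \<phi> \<psi>) f = convolution \<Delta> (point_map \<theta> \<phi>) (point_map \<theta> \<psi>) f"
    by (simp add: point_map_def convolution_def algebra_homsD(3)[OF \<theta>])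
qed

lemma antipode_point:
  assumes "graded_commutative \<omega> H" "\<phi> \<in> algebra_homs H R"
  shows "(\<lambda>f. \<phi> (S f)) \<in> algebra_homs H R"
  using algebra_homs_compose[OF antipode_in_algebra_homs[OF assms(1)] assms(2)] by (simp add: comp_def)

lemma group_point_group:
  assumes H: "graded_commutative \<omega> H" and R: "graded_algebra R" "graded_commutative \<omega> R"
  shows "group (point_group H \<Delta> \<epsilon> R)"
\<comment> \<open>\<open>groupI\<close> asks for a left unit and left inverses; these come from
  \<open>counit_left\<close> and \<open>antipode_left\<close>.\<close>
proof (rule groupI)
  fix \<phi> assume "\<phi> \<in> carrier (point_group H \<Delta> \<epsilon> R)"
  then show "\<exists>\<psi>\<in>carrier (point_group H \<Delta> \<epsilon> R).
      \<psi> \<otimes>\<^bsub>point_group H \<Delta> \<epsilon> R\<^esub> \<phi> = \<one>\<^bsub>point_group H \<Delta> \<epsilon> R\<^esub>"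
    by (intro bexI[of _ "\<lambda>f. \<phi> (S f)"])
      (simp_all add: point_group_def antipode_convolution antipode_point[OF H])
qed (simp_all add: point_group_def counit_in_algebra_homs[OF R(1)]
    convolution_in_algebra_homs[OF R] convolution_assoc counit_convolution algebra_homsD(1))

text \<open>In a group a left inverse is the inverse, so \<open>antipode_convolution\<close>
  identifies it.\<close>

lemma inv_point_group:
  assumes H: "graded_commutative \<omega> H" and R: "graded_algebra R" "graded_commutative \<omega> R"
    and \<phi>: "\<phi> \<in> algebra_homs H R"
  shows "inv\<^bsub>point_group H \<Delta> \<epsilon> R\<^esub> \<phi> = (\<lambda>f. \<phi> (S f))"
  by (rule group.inv_equality[OF group_point_group[OF H R]])
    (simp_all add: point_group_def \<phi> antipode_convolution[OF \<phi>] antipode_point[OF H \<phi>])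

lemma point_map_hom:
  assumes "\<theta> \<in> algebra_homs R R'"
  shows "point_map \<theta> \<in> hom (point_group H \<Delta> \<epsilon> R) (point_group H \<Delta> \<epsilon> R')"
proof (rule homI)
  fix \<phi> assume "\<phi> \<in> carrier (point_group H \<Delta> \<epsilon> R)"
  then show "point_map \<theta> \<phi> \<in> carrier (point_group H \<Delta> \<epsilon> R')"
    by (simp add: point_group_def point_map_def algebra_homs_compose[OF _ assms])
qed (simp add: point_group_def point_map_convolution[OF _ _ assms])

end

theorem lemma6p28:
  fixes \<omega> :: "'g::ab_group_add \<Rightarrow> 'g \<Rightarrow> complex"
    and H :: "'g \<Rightarrow> 'h::complex_algebra set"
    and \<Delta> :: "'h \<Rightarrow> ('h, 'h) tensor"
    and \<epsilon> :: "'h \<Rightarrow> complex"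
    and S :: "'h \<Rightarrow> 'h"
  assumes "hopf_algebra \<omega> H \<Delta> \<epsilon> S"
    and "graded_commutative \<omega> H"
  shows
    "(\<forall>R :: 'g \<Rightarrow> 'r::complex_algebra set. test_algebra \<omega> R \<longrightarrow>
        group (point_group H \<Delta> \<epsilon> R) \<and>
        (\<forall>\<phi>\<in>algebra_homs H R. inv\<^bsub>point_group H \<Delta> \<epsilon> R\<^esub> \<phi> = (\<lambda>f. \<phi> (S f)))) \<and>
     (\<forall>(R :: 'g \<Rightarrow> 'r set) (R' :: 'g \<Rightarrow> 's::complex_algebra set) \<theta>.
        test_algebra \<omega> R \<longrightarrow> test_algebra \<omega> R' \<longrightarrow> \<theta> \<in> algebra_homs R R' \<longrightarrow>
        point_map \<theta> \<in> hom (point_group H \<Delta> \<epsilon> R) (point_group H \<Delta> \<epsilon> R') \<and>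
        (\<forall>\<phi>\<in>algebra_homs H R. \<forall>\<psi>\<in>algebra_homs H R.
          point_map \<theta> (convolution \<Delta> \<phi> \<psi>) = convolution \<Delta> (point_map \<theta> \<phi>) (point_map \<theta> \<psi>)) \<and>
        (\<forall>\<phi>\<in>algebra_homs H R. point_map \<theta> (\<lambda>f. \<phi> (S f)) = (\<lambda>f. point_map \<theta> \<phi> (S f)))) \<and>
     (\<forall>R :: 'g \<Rightarrow> 'r set. test_algebra \<omega> R \<longrightarrow>
        (\<forall>\<phi>\<in>algebra_homs H R. point_map id \<phi> = \<phi>)) \<and>
     (\<forall>(R :: 'g \<Rightarrow> 'r set) (R' :: 'g \<Rightarrow> 's set) (R'' :: 'g \<Rightarrow> 't::complex_algebra set) \<theta> \<theta>'.
        test_algebra \<omega> R \<longrightarrow> test_algebra \<omega> R' \<longrightarrow> test_algebra \<omega> R'' \<longrightarrow>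
        \<theta> \<in> algebra_homs R R' \<longrightarrow> \<theta>' \<in> algebra_homs R' R'' \<longrightarrow>
        (\<forall>\<phi>\<in>algebra_homs H R.
          point_map (\<theta>' \<circ> \<theta>) \<phi> = point_map \<theta>' (point_map \<theta> \<phi>)))"
proof -
  interpret hopf_algebra \<omega> H \<Delta> \<epsilon> S by fact
  note H = assms(2)
  show ?thesis
    \<comment> \<open>The second \<open>auto\<close> settles naturality of the inverse and
      preservation of identities and composites, where unfolding \<open>point_map\<close> to
      composition suffices.\<close>
    by (auto simp: test_algebra_def group_point_group[OF H] inv_point_group[OF H] point_map_hom
        point_map_convolution) (auto simp: point_map_def)
qed

end
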